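(* For some $C_0>0$, $$\Big|P_n\Big(\frac{3\pi}{2n}\Big)\Big|\le n^{C_0}e^{An}$$ and $$\Big|P_n\Big(\frac{3\pi}{2n}\Big)\Big|\ge n^{-C_0}e^{An}.$$
   Context: Let $\mathbb{T}=\mathbb{R}/2\pi\mathbb{Z}$, and define $P_n:\mathbb{T}\to\mathbb{C}$ by $P_n(\theta)=\prod_{k=1}^n(1-e^{ik\theta})$. Let $A=\frac{2G}{3\pi}$, where $G=\sum_{m=0}^\infty\frac{(-1)^m}{(2m+1)^2}=0.9159655942\ldots$ is Catalan's constant.
   Formalization: The bounds are stated for all integers n ≥ 2 with one constant C_0; n = 1 is excluded because there |P_1(3π/2)| = √2 exceeds 1^{C_0} e^A ≈ 1.215 for every C_0, so the upper bound fails. *)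

theory Defs
  imports "HOL-Analysis.Analysis"
begin

definition catalan_G :: real where
  "catalan_G = (\<Sum>m. (-1) ^ m / (2 * real m + 1) ^ 2)"

lemma summable_catalan_G: "summable (\<lambda>m. (-1) ^ m / (2 * real m + 1) ^ 2 :: real)"
proof (rule summable_comparison_test')
  show "summable (\<lambda>m. 1 / real (Suc m) ^ 2)"
    using inverse_squares_sums by (simp add: sums_iff add.commute)
  show "norm ((-1) ^ m / (2 * real m + 1) ^ 2) \<le> 1 / real (Suc m) ^ 2" if "m \<ge> 0" for m
    by (simp add: norm_divide norm_power frac_le power_mono)
qed

definition A_const :: real where
  "A_const = 2 * catalan_G / (3 * pi)"

text \<open>A function on the circle \<open>\<real> / 2\<pi>\<int>\<close> is represented by its
  \<open>2\<pi>\<close>-periodic lift to the real line; see \<open>P_periodic\<close>.\<close>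

definition P :: "nat \<Rightarrow> real \<Rightarrow> complex" where
  "P n \<theta> = (\<Prod>k=1..n. 1 - exp (\<i> * of_nat k * of_real \<theta>))"

lemma P_periodic: "P n (\<theta> + 2 * pi * of_int j) = P n \<theta>"
proof -
  have "exp (\<i> * of_nat k * of_real (\<theta> + 2 * pi * of_int j)) = exp (\<i> * of_nat k * of_real \<theta>)" for k
    unfolding exp_eq by (rule exI[of _ "int k * j"]) (simp add: algebra_simps)
  then show ?thesis
    unfolding P_def by simp
qed

end

theory Submission
  imports Defs
begin

text \<open>
  By the Fourier expansion \<open>ln \<bar>1 - e\<^sup>i\<^sup>x\<bar> = - (\<Sum>m\<ge>1. cos (m x) / m)\<close>, the logarithm of
  the modulus of one factor is the derivative of \<open>- Cl\<close>, where \<open>Cl x = (\<Sum>m\<ge>1. sin (m x) / m\<^sup>2)\<close> is the Clausen function.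
  Hence \<open>ln \<bar>P n \<theta>\<bar>\<close> is \<open>1/\<theta>\<close> times a right Riemann sum with step \<open>\<theta>\<close> of a function whose
  integral over \<open>[0, n \<theta>]\<close> is \<open>- Cl (n \<theta>)\<close>. For \<open>\<theta> = 3 \<pi> / (2 n)\<close> the integral
  is \<open>- Cl (3 \<pi> / 2) = G\<close>, because \<open>sin (3 \<pi> m / 2)\<close> vanishes at even \<open>m\<close> and alternates
  at odd \<open>m\<close>; and \<open>G / \<theta> = A n\<close>.

  It remains to see that the Riemann sum costs only \<open>O(log n)\<close>. The integrand has a logarithmic
  singularity at \<open>0\<close>, but its derivative is at most \<open>3 / x\<close> in modulus on \<open>(0, 3 \<pi> / 2]\<close>. On the \<open>k\<close>-th
  subinterval this makes the error at most \<open>3 \<theta> / k\<close>, also for \<open>k = 1\<close>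
  (\<open>right_endpoint_error\<close>), and the harmonic sum of these errors is \<open>O(log n)\<close>.

  To keep the singularity, and the conditionally convergent Fourier series, out of the
  calculation, everything is done for \<open>ln \<bar>1 - r e\<^sup>i\<^sup>x\<bar>\<close> with \<open>0 \<le> r < 1\<close>. This function is
  smooth and its series converges absolutely. The bound \<open>3 / x\<close> is uniform in \<open>r\<close>
  (\<open>ln_norm_derivative_bound\<close>), so for fixed \<open>n\<close> the limit \<open>r \<rightarrow> 1\<close> can be taken in the final
  inequality (\<open>ln_norm_P_approximation\<close>), where only finitely many points \<open>k \<theta>\<close>, all away from
  the singularity, are involved.
\<close>

section \<open>Right Riemann sums near a logarithmic singularity\<close>

text \<open>
  The error is the increment over \<open>[a, b]\<close> of \<open>(x - a) * f x - F x\<close>, whose derivative is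
  \<open>(x - a) * f' x\<close>. The factor \<open>x - a\<close> absorbs the growth of \<open>f'\<close> at \<open>0\<close>: since
  \<open>(x - a) / x\<close> increases with \<open>x\<close>, the bound stays finite even for \<open>a = 0\<close>.
\<close>

lemma right_endpoint_error:
  fixes F f f' :: "real \<Rightarrow> real"
  assumes F: "\<And>x. (F has_real_derivative f x) (at x)"
    and f: "\<And>x. (f has_real_derivative f' x) (at x)"
    and B: "\<And>x. 0 < x \<Longrightarrow> x \<le> b \<Longrightarrow> \<bar>x * f' x\<bar> \<le> B"
    and "0 \<le> a" "a < b"
  shows "\<bar>(b - a) * f b - (F b - F a)\<bar> \<le> B * (b - a)\<^sup>2 / b"
proof -
  define G where "G x = (x - a) * f x - F x" for x
  have G: "(G has_real_derivative (x - a) * f' x) (at x)" for x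
    unfolding G_def by (auto intro!: derivative_eq_intros F f)
  obtain z where z: "a < z" "z < b" and mvt: "G b - G a = (b - a) * ((z - a) * f' z)"
    using MVT2[OF \<open>a < b\<close>, of G "\<lambda>x. (x - a) * f' x"] G by blast
  have "0 < z" using z assms by linarith
  have "(z - a) / z \<le> (b - a) / b"
    using z \<open>0 \<le> a\<close> \<open>0 < z\<close> by (simp add: field_simps mult_left_mono)
  moreover have "\<bar>z * f' z\<bar> \<le> B" using B \<open>0 < z\<close> z by simp
  moreover have "0 \<le> (z - a) / z" using z \<open>0 < z\<close> by simp
  ultimately have "(z - a) / z * \<bar>z * f' z\<bar> \<le> (b - a) / b * B"
    by (intro mult_mono) auto
  moreover have "\<bar>(z - a) * f' z\<bar> = (z - a) / z * \<bar>z * f' z\<bar>"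
    using z \<open>0 < z\<close> by (simp add: abs_mult)
  ultimately have "\<bar>(z - a) * f' z\<bar> \<le> (b - a) / b * B" by simp
  hence "(b - a) * \<bar>(z - a) * f' z\<bar> \<le> (b - a) * ((b - a) / b * B)"
    using \<open>a < b\<close> by (intro mult_left_mono) auto
  hence "\<bar>G b - G a\<bar> \<le> B * (b - a)\<^sup>2 / b"
    using \<open>a < b\<close> by (simp add: mvt abs_mult power2_eq_square mult_ac)
  thus ?thesis by (simp add: G_def algebra_simps)
qed

text \<open>
  With \<open>a = (k - 1) h\<close> and \<open>b = k h\<close> the bound of the preceding lemma is \<open>B h / k\<close>; after
  division by \<open>h\<close> these errors add up to a multiple of a harmonic number that does not depend
  on \<open>h\<close>.
\<close>

lemma right_Riemann_sum_error:
  fixes F f f' :: "real \<Rightarrow> real"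
  assumes F: "\<And>x. (F has_real_derivative f x) (at x)"
    and f: "\<And>x. (f has_real_derivative f' x) (at x)"
    and B: "\<And>x. 0 < x \<Longrightarrow> x \<le> real n * h \<Longrightarrow> \<bar>x * f' x\<bar> \<le> B"
    and "0 < h"
  shows "\<bar>(\<Sum>k=1..n. f (real k * h)) - (F (real n * h) - F 0) / h\<bar> \<le> B * harm n"
  using B
proof (induction n)
  case 0
  thus ?case by (simp add: harm_def)
next
  case (Suc n)
  let ?a = "real n * h" and ?b = "real (Suc n) * h"
  have step: "?b - ?a = h" by (simp add: algebra_simps)
  have "\<bar>(?b - ?a) * f ?b - (F ?b - F ?a)\<bar> \<le> B * (?b - ?a)\<^sup>2 / ?b"
    using \<open>0 < h\<close> by (intro right_endpoint_error[OF F f] Suc.prems) auto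
  hence "\<bar>h * f ?b - (F ?b - F ?a)\<bar> \<le> B * h\<^sup>2 / ?b"
    unfolding step .
  also have "B * h\<^sup>2 / ?b = h * (B / real (Suc n))"
    using \<open>0 < h\<close> by (simp add: power2_eq_square field_simps del: of_nat_Suc)
  finally have "\<bar>h * f ?b - (F ?b - F ?a)\<bar> / h \<le> B / real (Suc n)"
    using \<open>0 < h\<close> by (simp add: pos_divide_le_eq mult.commute)
  moreover have "\<bar>h * f ?b - (F ?b - F ?a)\<bar> / h = \<bar>f ?b - (F ?b - F ?a) / h\<bar>"
  proof -
    have "h * f ?b - (F ?b - F ?a) = h * (f ?b - (F ?b - F ?a) / h)"
      using \<open>0 < h\<close> unfolding right_diff_distrib by simp
    thus ?thesis using \<open>0 < h\<close> by (simp only: abs_mult) simp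
  qed
  ultimately have last: "\<bar>f ?b - (F ?b - F ?a) / h\<bar> \<le> B / real (Suc n)"
    by linarith
  have "\<bar>(\<Sum>k=1..n. f (real k * h)) - (F ?a - F 0) / h\<bar> \<le> B * harm n"
  proof (rule Suc.IH)
    fix x :: real assume "0 < x" "x \<le> ?a"
    moreover from this have "x \<le> ?b" using step \<open>0 < h\<close> by linarith
    ultimately show "\<bar>x * f' x\<bar> \<le> B" using Suc.prems by blast
  qed
  moreover have "(F ?b - F 0) / h = (F ?b - F ?a) / h + (F ?a - F 0) / h"
    by (simp add: diff_divide_distrib)
  moreover have "B * harm (Suc n) = B * harm n + B / real (Suc n)"
    by (simp add: harm_Suc algebra_simps divide_inverse)
  moreover have "(\<Sum>k=1..Suc n. f (real k * h)) = (\<Sum>k=1..n. f (real k * h)) + f ?b"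
    by simp
  ultimately show ?case using last by linarith
qed

section \<open>The Abel-regularised Clausen function\<close>

text \<open>
  This is the imaginary part of \<open>Li\<^sub>2 (r e\<^sup>i\<^sup>x)\<close>, and Clausen's function \<open>Cl\<^sub>2\<close> for \<open>r = 1\<close>.
  The summand for \<open>m = 0\<close> is \<open>0 / 0 = 0\<close>.
\<close>

definition clausen :: "real \<Rightarrow> real \<Rightarrow> real" where
  "clausen r x = (\<Sum>m. r ^ m * sin (real m * x) / (real m)\<^sup>2)"

lemma clausen_0 [simp]: "clausen r 0 = 0"
  by (simp add: clausen_def)

lemma summable_inverse_square: "summable (\<lambda>m. 1 / (real m)\<^sup>2)"
  using inverse_power_summable[of 2, where 'a = real] by (simp add: divide_inverse)

lemma clausen_term_bound:
  assumes "0 \<le> r" "r \<le> 1"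
  shows "norm (r ^ m * sin (real m * x) / (real m)\<^sup>2) \<le> 1 / (real m)\<^sup>2"
proof -
  have "r ^ m * \<bar>sin (real m * x)\<bar> \<le> 1 * 1"
    using assms by (intro mult_mono power_le_one) auto
  thus ?thesis using assms by (simp add: abs_mult power_abs divide_right_mono)
qed

text \<open>
  The coefficients of \<open>r ^ m\<close> are absolutely summable, so the series converges uniformly up to
  and including \<open>r = 1\<close>.
\<close>

lemma tendsto_clausen: "((\<lambda>r. clausen r x) \<longlongrightarrow> clausen 1 x) (at_left 1)"
proof -
  have "continuous_on {0..1} (\<lambda>r. clausen r x)"
    unfolding clausen_def
  proof (rule uniform_limit_theorem)
    show "\<forall>\<^sub>F n in sequentially. continuous_on {0..1}
            (\<lambda>r. \<Sum>m<n. r ^ m * sin (real m * x) / (real m)\<^sup>2)"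
      unfolding divide_inverse by (intro always_eventually allI continuous_intros)
    show "uniform_limit {0..1} (\<lambda>n r. \<Sum>m<n. r ^ m * sin (real m * x) / (real m)\<^sup>2)
            (\<lambda>r. \<Sum>m. r ^ m * sin (real m * x) / (real m)\<^sup>2) sequentially"
      by (rule Weierstrass_m_test[OF _ summable_inverse_square]) (use clausen_term_bound in auto)
  qed simp
  hence "((\<lambda>r. clausen r x) \<longlongrightarrow> clausen 1 x) (at 1 within {0..1})"
    by (auto simp: continuous_on_def)
  moreover have "at (1::real) within {0..1} = at_left 1"
    by (rule at_within_Icc_at_left) simp
  ultimately show ?thesis by simp
qed

text \<open>This is the real part of the Taylor series of \<open>Ln (1 - z)\<close> at \<open>z = r e\<^sup>i\<^sup>x\<close>.\<close>

lemma log_norm_series: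
  assumes "0 \<le> r" "r < 1"
  shows "(\<lambda>m. - (r ^ m * cos (real m * x) / real m)) sums ln (norm (1 - of_real r * cis x))"
proof -
  have n: "norm (- (of_real r * cis x)) < 1" using assms by (simp add: norm_mult)
  have ne: "1 - of_real r * cis x \<noteq> 0"
  proof
    assume "1 - of_real r * cis x = 0"
    hence "norm (of_real r * cis x) = 1" by (metis norm_one right_minus_eq)
    thus False using assms by (simp add: norm_mult)
  qed
  have "Re (- ((of_real r * cis x) ^ m) / of_nat m) = - (r ^ m * cos (real m * x) / real m)" for m
    by (simp add: power_mult_distrib Complex.DeMoivre Re_divide_of_nat flip: of_real_power)
  thus ?thesis
    using sums_Re[OF Ln_series'[OF n]]
    by (simp only: minus_minus diff_conv_add_uminus[symmetric] Re_Ln[OF ne])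
qed

text \<open>
  For \<open>r < 1\<close> the differentiated series is dominated by the geometric series, uniformly in
  \<open>x\<close>, so it may be differentiated term by term.
\<close>

lemma clausen_has_derivative:
  assumes "0 \<le> r" "r < 1"
  shows "((\<lambda>x. - clausen r x) has_real_derivative ln (norm (1 - of_real r * cis x))) (at x)"
proof -
  let ?f = "\<lambda>m x. - (r ^ m * sin (real m * x) / (real m)\<^sup>2)"
  let ?g = "\<lambda>m x. - (r ^ m * cos (real m * x) / real m)"
  have der: "(?f m has_real_derivative ?g m x) (at x within UNIV)" for m x
    by (cases "m = 0") (auto intro!: derivative_eq_intros simp: power2_eq_square)
  have bound: "norm (?g m x) \<le> r ^ m" for m x
  proof (cases "m = 0")
    case False
    have "r ^ m * (\<bar>cos (real m * x)\<bar> / real m) \<le> r ^ m * 1"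
      using assms False by (intro mult_left_mono) (auto simp: divide_le_eq intro: order_trans[OF abs_cos_le_one])
    thus ?thesis using assms by (simp add: abs_mult power_abs)
  qed simp
  have conv: "uniformly_convergent_on UNIV (\<lambda>n x. \<Sum>i<n. ?g i x)"
    by (rule Weierstrass_m_test'[OF bound]) (use assms in \<open>auto intro: summable_geometric\<close>)
  have "((\<lambda>x. \<Sum>m. ?f m x) has_real_derivative (\<Sum>m. ?g m x)) (at x)"
    by (rule has_field_derivative_series'(2)[OF convex_UNIV der conv, of 0]) auto
  moreover have "(\<Sum>m. ?f m x) = - clausen r x" for x
    unfolding clausen_def
    by (rule suminf_minus, rule summable_comparison_test'[OF summable_inverse_square])
       (use clausen_term_bound assms in auto)
  moreover have "(\<Sum>m. ?g m x) = ln (norm (1 - of_real r * cis x))"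
    using log_norm_series[OF assms] by (simp add: sums_iff)
  ultimately show ?thesis by simp
qed

lemma clausen_three_quarters: "clausen 1 (3 * pi / 2) = - catalan_G"
proof -
  let ?f = "\<lambda>m. sin (real m * (3 * pi / 2)) / (real m)\<^sup>2"
  have odd: "?f (2 * j + 1) = - ((-1) ^ j / (2 * real j + 1)\<^sup>2)" for j
  proof -
    have "real (2 * j + 1) * (3 * pi / 2) = real (3 * j + 1) * pi + pi / 2"
      by (simp add: field_simps)
    also have "sin \<dots> = cos (real (3 * j + 1) * pi)"
      by (simp add: sin_add)
    also have "\<dots> = (-1) ^ (3 * j + 1)" by (rule cos_npi)
    also have "\<dots> = - ((-1) ^ j)" by (simp add: power_mult)
    finally show ?thesis by simp
  qed
  have even: "?f m = 0" if "m \<notin> range (\<lambda>j. 2 * j + 1)" for m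
  proof -
    have "even m" using that by (metis oddE rangeI)
    then obtain j where "m = 2 * j" by blast
    hence "real m * (3 * pi / 2) = real (3 * j) * pi" by simp
    thus ?thesis by (simp only: sin_npi div_0)
  qed
  have "(\<lambda>j. - ((-1) ^ j / (2 * real j + 1)\<^sup>2)) sums - catalan_G"
    unfolding catalan_G_def by (intro sums_minus summable_sums summable_catalan_G)
  hence "(\<lambda>j. ?f (2 * j + 1)) sums - catalan_G" by (simp only: odd)
  hence "?f sums - catalan_G"
    using sums_mono_reindex[of "\<lambda>j. 2 * j + 1" ?f] even by (simp add: strict_mono_def)
  thus ?thesis by (simp add: clausen_def sums_iff)
qed

section \<open>The logarithm of the product\<close>

lemma norm_one_minus_cis_squared:
  "(norm (1 - of_real r * cis x))\<^sup>2 = 1 - 2 * r * cos x + r\<^sup>2"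
proof -
  have "(1 - r * cos x)\<^sup>2 + (r * sin x)\<^sup>2 = 1 - 2 * r * cos x + r\<^sup>2 * ((sin x)\<^sup>2 + (cos x)\<^sup>2)"
    by algebra
  thus ?thesis by (simp add: cmod_power2)
qed

lemma ln_norm_has_derivative:
  assumes "0 \<le> r" "r < 1"
  shows "((\<lambda>x. ln (norm (1 - of_real r * cis x))) has_real_derivative
           r * sin x / (1 - 2 * r * cos x + r\<^sup>2)) (at x)"
proof -
  have pos: "0 < 1 - 2 * r * cos x + r\<^sup>2" for x
  proof -
    have "r * cos x \<le> r * 1" using assms by (intro mult_left_mono) auto
    moreover have "0 < (1 - r)\<^sup>2" using assms by simp
    ultimately show ?thesis by (simp add: power2_eq_square algebra_simps)
  qed
  have "ln (norm (1 - of_real r * cis x)) = ln (1 - 2 * r * cos x + r\<^sup>2) / 2" for x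
  proof -
    have "0 < norm (1 - of_real r * cis x)"
      using pos[of x] norm_one_minus_cis_squared[of r x] by (cases "1 - of_real r * cis x = 0") auto
    thus ?thesis unfolding norm_one_minus_cis_squared[symmetric] by (simp add: ln_realpow)
  qed
  moreover have "((\<lambda>x. ln (1 - 2 * r * cos x + r\<^sup>2) / 2) has_real_derivative
           r * sin x / (1 - 2 * r * cos x + r\<^sup>2)) (at x)"
    using pos[of x] by (auto intro!: derivative_eq_intros simp: field_simps)
  ultimately show ?thesis by (simp only:)
qed

text \<open>
  This bounds \<open>u cot u\<close> without dividing by the sine. Below \<open>\<pi> / 2\<close> this is \<open>u \<le> tan u\<close>; from there up to
  \<open>3 \<pi> / 4\<close> the cotangent is at least \<open>-1\<close> and \<open>3 \<pi> / 4 < 3\<close>.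
\<close>

lemma abs_mult_cos_le_sin:
  assumes "0 < u" "u \<le> 3 * pi / 4"
  shows "\<bar>u * cos u\<bar> \<le> 3 * sin u"
proof (cases "u < pi / 2")
  case True
  have "u \<le> tan u" using abs_tan_ge[of u] tan_pos_pi2_le[of u] True assms by simp
  moreover have "0 < cos u" using True assms by (intro cos_gt_zero) auto
  ultimately have "u * cos u \<le> sin u" by (simp add: tan_def field_simps)
  moreover have "0 \<le> sin u" using True assms by (intro sin_ge_zero) auto
  ultimately show ?thesis using \<open>0 < cos u\<close> \<open>0 < u\<close> by (simp add: abs_mult)
next
  case False
  have "cos u \<le> 0"
    using False assms cos_ge_zero[of "pi - u"] by auto
  have "0 \<le> sin (u + pi / 4)" using assms by (intro sin_ge_zero) auto
  hence "0 \<le> (sqrt 2 / 2) * (sin u + cos u)" by (simp add: sin_add sin_45 cos_45 algebra_simps)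
  hence "- cos u \<le> sin u" by (simp add: zero_le_mult_iff)
  moreover have "u \<le> 3" using assms pi_less_4 by linarith
  ultimately have "u * - cos u \<le> 3 * sin u" using assms \<open>cos u \<le> 0\<close> by (intro mult_mono) auto
  moreover have "u * cos u \<le> 0" using assms \<open>cos u \<le> 0\<close> by (simp add: mult_le_0_iff)
  ultimately show ?thesis by simp
qed

text \<open>
  With \<open>u = x / 2\<close> the denominator is \<open>(1 - r)\<^sup>2 + 4 r sin\<^sup>2 u \<ge> 4 r sin\<^sup>2 u\<close> and the numerator
  contains \<open>r sin x = 2 r sin u cos u\<close>, so the product is at most \<open>\<bar>u cot u\<bar>\<close>, whatever \<open>r\<close>
  is. This uniformity is what allows the passage to \<open>r = 1\<close>.
\<close>

lemma ln_norm_derivative_bound: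
  assumes "0 \<le> r" "r < 1" "0 < x" "x \<le> 3 * pi / 2"
  shows "\<bar>x * (r * sin x / (1 - 2 * r * cos x + r\<^sup>2))\<bar> \<le> 3"
proof -
  define u where "u = x / 2"
  have x: "x = 2 * u" by (simp add: u_def)
  have u: "0 < u" "u \<le> 3 * pi / 4" using assms by (auto simp: u_def)
  have s: "0 < sin u" using u by (intro sin_gt_zero) (use pi_gt_zero in linarith)+
  have D: "1 - 2 * r * cos x + r\<^sup>2 = (1 - r)\<^sup>2 + 4 * r * (sin u)\<^sup>2"
    unfolding x cos_double_sin by algebra
  have pos: "0 < (1 - r)\<^sup>2 + 4 * r * (sin u)\<^sup>2"
    using assms by (intro add_pos_nonneg) auto
  have "\<bar>x * (r * sin x)\<bar> = 4 * r * sin u * \<bar>u * cos u\<bar>"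
    using s assms by (simp add: x sin_double abs_mult)
  also have "\<dots> \<le> 4 * r * sin u * (3 * sin u)"
    using s assms by (intro mult_left_mono abs_mult_cos_le_sin u) auto
  also have "\<dots> \<le> 3 * ((1 - r)\<^sup>2 + 4 * r * (sin u)\<^sup>2)"
    by (simp add: power2_eq_square)
  finally show ?thesis unfolding D using pos by (simp add: abs_mult pos_divide_le_eq)
qed

lemma one_minus_cis_nonzero:
  assumes "0 < x" "x < 2 * pi"
  shows "1 - cis x \<noteq> 0"
proof
  assume "1 - cis x = 0"
  hence "cos x = 1" by (simp add: complex_eq_iff)
  then obtain j :: int where "x = of_int j * 2 * pi" unfolding cos_one_2pi_int by blast
  hence "0 < real_of_int j" "real_of_int j < 1" using assms pi_gt_zero
    by (auto simp: zero_less_mult_iff)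
  thus False by simp
qed

text \<open>
  For \<open>r < 1\<close> the Riemann sum estimate applies on all of \<open>[0, n \<theta>]\<close>, with an error independent
  of \<open>r\<close>. For fixed \<open>n\<close> and \<open>\<theta>\<close> the estimated quantity is continuous up to
  \<open>r = 1\<close>: no factor of \<open>P n \<theta>\<close> vanishes, because \<open>0 < k \<theta> < 2 \<pi>\<close>.
\<close>

lemma ln_norm_P_approximation:
  assumes "0 < \<theta>" "real n * \<theta> \<le> 3 * pi / 2"
  shows "P n \<theta> \<noteq> 0" "\<bar>ln (norm (P n \<theta>)) + clausen 1 (real n * \<theta>) / \<theta>\<bar> \<le> 3 * harm n"
proof -
  have factor: "1 - cis (real k * \<theta>) \<noteq> 0" if "k \<in> {1..n}" for k
  proof (rule one_minus_cis_nonzero)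
    show "0 < real k * \<theta>" using that assms by simp
    have "real k * \<theta> \<le> real n * \<theta>" using that assms by (intro mult_right_mono) auto
    thus "real k * \<theta> < 2 * pi" using assms pi_gt_zero by linarith
  qed
  have P: "P n \<theta> = (\<Prod>k=1..n. 1 - cis (real k * \<theta>))"
    by (simp add: P_def cis_conv_exp mult_ac)
  show "P n \<theta> \<noteq> 0" unfolding P using factor by simp
  have ln_P: "ln (norm (P n \<theta>)) = (\<Sum>k=1..n. ln (norm (1 - cis (real k * \<theta>))))"
    unfolding P prod_norm[symmetric] using factor by (intro ln_prod) auto
  have bound: "\<bar>(\<Sum>k=1..n. ln (norm (1 - of_real r * cis (real k * \<theta>)))) + clausen r (real n * \<theta>) / \<theta>\<bar>
        \<le> 3 * harm n" if r: "0 \<le> r" "r < 1" for r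
    using right_Riemann_sum_error[OF clausen_has_derivative[OF r] ln_norm_has_derivative[OF r], of n \<theta> 3]
      ln_norm_derivative_bound[OF r] assms by simp
  have "((\<lambda>r. \<Sum>k=1..n. ln (norm (1 - of_real r * cis (real k * \<theta>)))) \<longlongrightarrow>
          (\<Sum>k=1..n. ln (norm (1 - of_real 1 * cis (real k * \<theta>))))) (at_left 1)"
    using factor by (intro tendsto_sum tendsto_ln tendsto_norm tendsto_intros) auto
  hence "((\<lambda>r. \<bar>(\<Sum>k=1..n. ln (norm (1 - of_real r * cis (real k * \<theta>)))) + clausen r (real n * \<theta>) / \<theta>\<bar>)
        \<longlongrightarrow> \<bar>ln (norm (P n \<theta>)) + clausen 1 (real n * \<theta>) / \<theta>\<bar>) (at_left 1)"
    using assms by (auto simp: ln_P intro!: tendsto_intros tendsto_clausen)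
  moreover have "eventually (\<lambda>r. \<bar>(\<Sum>k=1..n. ln (norm (1 - of_real r * cis (real k * \<theta>))))
        + clausen r (real n * \<theta>) / \<theta>\<bar> \<le> 3 * harm n) (at_left (1::real))"
    by (rule eventually_mono[OF eventually_at_left_real[of 0 1]]) (use bound in auto)
  ultimately show "\<bar>ln (norm (P n \<theta>)) + clausen 1 (real n * \<theta>) / \<theta>\<bar> \<le> 3 * harm n"
    by (rule tendsto_upperbound) simp
qed

lemma harm_le_ln:
  assumes "1 \<le> n"
  shows "harm n \<le> 1 + ln (real n)"
  using decseqD[OF decseq_harm_diff_ln, of 0 "n - 1"] assms by (simp add: harm_def)

theorem theorem3:
  "\<exists>C\<^sub>0 > (0::real). \<forall>n::nat. n \<ge> 2 \<longrightarrow>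
     norm (P n (3 * pi / (2 * real n))) \<le> real n powr C\<^sub>0 * exp (A_const * real n) \<and>
     norm (P n (3 * pi / (2 * real n))) \<ge> real n powr (- C\<^sub>0) * exp (A_const * real n)"
proof (intro exI[of _ 9] conjI allI impI)
  fix n :: nat assume n: "2 \<le> n"
  let ?\<theta> = "3 * pi / (2 * real n)"
  have angle: "real n * ?\<theta> = 3 * pi / 2" using n by simp
  have nz: "P n ?\<theta> \<noteq> 0" and approx: "\<bar>ln (norm (P n ?\<theta>)) - catalan_G / ?\<theta>\<bar> \<le> 3 * harm n"
    using ln_norm_P_approximation[of ?\<theta> n] n unfolding angle clausen_three_quarters by auto
  have main: "catalan_G / ?\<theta> = A_const * real n" by (simp add: A_const_def)
  \<comment> \<open>The exponent: \<open>3 (1 + ln n) \<le> 9 ln n\<close> because \<open>ln n \<ge> ln 2 \<ge> 1/2\<close>.\<close>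
  have "1 / 2 \<le> ln (2::real)" using ln2_ge_two_thirds by simp
  also have "ln 2 \<le> ln (real n)" using n by simp
  finally have "3 * harm n \<le> 9 * ln (real n)"
    using harm_le_ln[of n] n by simp
  hence err: "\<bar>ln (norm (P n ?\<theta>)) - A_const * real n\<bar> \<le> 9 * ln (real n)"
    using approx main by linarith
  have norm: "norm (P n ?\<theta>) = exp (ln (norm (P n ?\<theta>)))" using nz by simp
  have bounds: "real n powr c * exp (A_const * real n) = exp (c * ln (real n) + A_const * real n)" for c
    using n by (simp add: powr_def exp_add)
  show "norm (P n ?\<theta>) \<le> real n powr 9 * exp (A_const * real n)"
    unfolding bounds by (subst norm) (use err in simp)
  show "real n powr (- 9) * exp (A_const * real n) \<le> norm (P n ?\<theta>)"
    unfolding bounds by (subst norm) (use err in simp)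
qed simp

end
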